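(* Let $D>1$ be an integer. Let $A$ and $B$ be two prime $D\times D$ integer matrices that are different, i.e., there is no unimodular matrix $U$ with $A=BU$. Then $A$ and $B$ are (left) co-prime.
   Context: All matrices are $D\times D$ with entries in $\mathbb{Z}$. A matrix is unimodular if its determinant is $1$ or $-1$, and non-unimodular otherwise. A nonsingular integer matrix $A$ is called prime if it cannot be factorized as a product of two non-unimodular integer matrices (in particular unimodular matrices count as prime). A matrix $A$ and $AU$, with $U$ unimodular, are regarded as the same matrix; "different" means not the same in this sense. A nonsingular integer matrix $C$ is a left divisor of an integer matrix $M$ if $C^{-1}M$ is an integer matrix. A common left divisor (cld) of several matrices is a matrix that is a left divisor of each of them; a greatest common left divisor (gcld) is a cld $A$ such that every other cld is a left divisor of $A$. Two matrices are (left) co-prime if their gcld is unimodular. *)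

theory Defs
  imports "HOL-Analysis.Analysis"
begin

definition unimodular :: "int^'n^'n \<Rightarrow> bool" where
  "unimodular U \<longleftrightarrow> det U = 1 \<or> det U = -1"

(* Unimodular matrices are prime under this definition. *)
definition prime_matrix :: "int^'n^'n \<Rightarrow> bool" where
  "prime_matrix A \<longleftrightarrow> det A \<noteq> 0 \<and>
     \<not> (\<exists>P Q. A = P ** Q \<and> \<not> unimodular P \<and> \<not> unimodular Q)"

(* The inverse of C is taken over the rationals, and the quotient is required
   to have integer entries. *)
definition left_divisor :: "int^'n^'n \<Rightarrow> int^'n^'n \<Rightarrow> bool" where
  "left_divisor C M \<longleftrightarrow> det C \<noteq> 0 \<and>
     (\<forall>i j. (matrix_inv (map_matrix rat_of_int C) ** map_matrix rat_of_int M) $ i $ j \<in> \<int>)"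

definition is_cld :: "int^'n^'n \<Rightarrow> (int^'n^'n) set \<Rightarrow> bool" where
  "is_cld C S \<longleftrightarrow> (\<forall>M\<in>S. left_divisor C M)"

definition is_gcld :: "int^'n^'n \<Rightarrow> (int^'n^'n) set \<Rightarrow> bool" where
  "is_gcld G S \<longleftrightarrow> is_cld G S \<and> (\<forall>C. is_cld C S \<longrightarrow> left_divisor C G)"

(* A gcld is determined only up to right multiplication by a unimodular matrix,
   so "their gcld is unimodular" is read as: a gcld exists and every gcld is
   unimodular. *)
definition left_coprime :: "int^'n^'n \<Rightarrow> int^'n^'n \<Rightarrow> bool" where
  "left_coprime A B \<longleftrightarrow>
     (\<exists>G. is_gcld G {A, B}) \<and> (\<forall>G. is_gcld G {A, B} \<longrightarrow> unimodular G)"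

end

theory Submission
  imports Defs
begin

text \<open>
  Every common left divisor of \<open>A = C X\<close> and \<open>B = C Y\<close> is unimodular: otherwise primality
  makes \<open>X\<close> and \<open>Y\<close> unimodular, so \<open>A = B Y\<^sup>-\<^sup>1 X\<close> and the matrices are not different. Hence
  the identity is a greatest common left divisor.
\<close>

lemma map_matrix_of_int_mult:
  "map_matrix of_int (A ** B) = map_matrix of_int A ** (map_matrix of_int B :: 'a::comm_ring_1^'p^'n)"
  by (simp add: map_matrix_def matrix_matrix_mult_def vec_eq_iff)

lemma det_map_matrix_of_int:
  "det (map_matrix of_int A :: 'a::comm_ring_1^'n^'n) = of_int (det A)"
  by (simp add: det_def map_matrix_def)

lemma map_matrix_of_int_one: "map_matrix of_int (mat 1) = (mat 1 :: 'a::ring_1^'n^'n)"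
  by (simp add: map_matrix_def mat_def vec_eq_iff)

lemma map_matrix_of_int_inject:
  "map_matrix of_int A = (map_matrix of_int B :: 'a::ring_char_0^'m^'n) \<longleftrightarrow> A = B"
  by (simp add: map_matrix_def vec_eq_iff)

text \<open>The way back from the rationals to the integers: it applies to expressions containing a
  rational inverse whose entries turn out to be integers.\<close>

lemma Ints_matrix_eq_map_matrix:
  fixes M :: "'a::ring_1^'m^'n"
  assumes "\<And>i j. M $ i $ j \<in> \<int>"
  shows "\<exists>X. M = map_matrix of_int X"
proof -
  have "\<exists>f. \<forall>i j. M $ i $ j = of_int (f i j)"
    using assms unfolding Ints_def image_iff by (intro choice allI) simp
  then obtain f where "\<forall>i j. M $ i $ j = of_int (f i j)" ..
  then have "M = map_matrix of_int (\<chi> i j. f i j)"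
    by (simp add: map_matrix_def vec_eq_iff)
  then show ?thesis ..
qed

lemma matrix_inv_of_int_cancel:
  fixes C :: "int^'n^'n"
  assumes "det C \<noteq> 0"
  shows "map_matrix rat_of_int C ** matrix_inv (map_matrix rat_of_int C) = mat 1"
    and "matrix_inv (map_matrix rat_of_int C) ** map_matrix rat_of_int C = mat 1"
proof -
  have "\<exists>X. map_matrix rat_of_int C ** X = mat 1 \<and> X ** map_matrix rat_of_int C = mat 1"
    using assms by (simp add: invertible_det_nz det_map_matrix_of_int flip: invertible_def)
  \<comment> \<open>\<open>matrix_inv\<close> is a Hilbert choice, so it is known to be an inverse
    only once some two-sided inverse exists; over the field of rationals a nonzero determinant
    provides one.\<close>
  from someI_ex[OF this]
  show "map_matrix rat_of_int C ** matrix_inv (map_matrix rat_of_int C) = mat 1"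
    and "matrix_inv (map_matrix rat_of_int C) ** map_matrix rat_of_int C = mat 1"
    by (simp_all add: matrix_inv_def)
qed

text \<open>The quotient \<open>X\<close> is the rational product of the inverse of \<open>C\<close>
  with \<open>M\<close>; cancelling \<open>C\<close> over the rationals and injectivity of
  \<open>of_int\<close> bring the factorization back to the integers.\<close>

lemma left_divisor_iff: "left_divisor C M \<longleftrightarrow> det C \<noteq> 0 \<and> (\<exists>X. M = C ** X)"
proof (cases "det C = 0")
  case False
  let ?C = "map_matrix rat_of_int C" and ?M = "map_matrix rat_of_int M"
  note inv = matrix_inv_of_int_cancel[OF False]
  have "\<exists>X. M = C ** X" if dvd: "left_divisor C M"
  proof -
    obtain X where "matrix_inv ?C ** ?M = map_matrix of_int X"
      using dvd Ints_matrix_eq_map_matrix unfolding left_divisor_def by blast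
    then have "?C ** (matrix_inv ?C ** ?M) = map_matrix of_int (C ** X)"
      by (simp add: map_matrix_of_int_mult)
    then have "?M = map_matrix of_int (C ** X)"
      by (simp add: matrix_mul_assoc inv)
    then show ?thesis
      by (auto simp: map_matrix_of_int_inject)
  qed
  moreover have "left_divisor C (C ** X)" for X
    using False
    by (simp add: left_divisor_def map_matrix_of_int_mult matrix_mul_assoc inv)
  ultimately show ?thesis
    using False by blast
qed (simp add: left_divisor_def)

text \<open>By Cramer's rule each entry of the rational inverse is an integer determinant divided by
  \<open>det U\<close>, which is 1 or -1, so the inverse is integral.\<close>

lemma unimodular_right_inverse:
  fixes U :: "int^'n^'n"
  assumes "unimodular U"
  shows "\<exists>V. U ** V = mat 1"
proof -
  let ?U = "map_matrix rat_of_int U"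
  have nz: "det U \<noteq> 0"
    using assms by (auto simp: unimodular_def)
  note inv = matrix_inv_of_int_cancel(1)[OF nz]
  have "matrix_inv ?U $ k $ j \<in> \<int>" for k j
  proof -
    \<comment> \<open>Cramer's numerator matrix, written over the integers: column \<open>k\<close>
      of \<open>U\<close> is replaced by the \<open>j\<close>-th unit vector.\<close>
    let ?N = "\<lambda>k. \<chi> i l. if l = k then mat 1 $ i $ j else U $ i $ l"
    \<comment> \<open>Column \<open>j\<close> of the inverse solves the linear system whose
      right-hand side is the \<open>j\<close>-th unit vector.\<close>
    have "?U *v column j (matrix_inv ?U) = column j (?U ** matrix_inv ?U)"
      by (simp add: column_def matrix_vector_mult_def matrix_matrix_mult_def)
    then have "?U *v column j (matrix_inv ?U) = column j (mat 1)"
      by (simp only: inv)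
    then have "column j (matrix_inv ?U) $ k =
        det (\<chi> i l. if l = k then column j (mat 1) $ i else ?U $ i $ l) / det ?U"
      using nz by (simp add: cramer det_map_matrix_of_int)
    also have "(\<chi> i l. if l = k then column j (mat 1) $ i else ?U $ i $ l) =
        map_matrix rat_of_int (?N k)"
      by (auto simp: map_matrix_def vec_eq_iff column_def mat_def)
    finally have "matrix_inv ?U $ k $ j = of_int (det (?N k)) / of_int (det U)"
      by (simp add: column_def det_map_matrix_of_int)
    then show ?thesis
      using assms by (auto simp: unimodular_def)
  qed
  then obtain V where "matrix_inv ?U = map_matrix of_int V"
    using Ints_matrix_eq_map_matrix by blast
  then have "map_matrix rat_of_int (U ** V) = map_matrix rat_of_int (mat 1)"
    using inv by (simp add: map_matrix_of_int_mult map_matrix_of_int_one)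
  then have "U ** V = mat 1"
    by (simp only: map_matrix_of_int_inject)
  then show ?thesis ..
qed

lemma unimodular_mult:
  "unimodular U \<Longrightarrow> unimodular V \<Longrightarrow> unimodular (U ** V)"
  by (auto simp: unimodular_def det_mul)

lemma unimodular_inverse:
  fixes U :: "int^'n^'n"
  assumes "unimodular U"
  obtains V where "unimodular V" "U ** V = mat 1"
proof -
  obtain V where V: "U ** V = mat 1"
    using unimodular_right_inverse[OF assms] ..
  then have "det U * det V = 1"
    by (metis det_I det_mul)
  then have "unimodular V"
    using assms by (auto simp: unimodular_def)
  then show thesis
    using V by (rule that)
qed

lemma is_cld_prime_matrices_unimodular:
  fixes A B C :: "int^'n^'n"
  assumes "prime_matrix A" "prime_matrix B"
    and different: "\<not> (\<exists>U. unimodular U \<and> A = B ** U)"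
    and "is_cld C {A, B}"
  shows "unimodular C"
proof (rule ccontr)
  assume C: "\<not> unimodular C"
  obtain X Y where X: "A = C ** X" and Y: "B = C ** Y"
    using assms(4) by (auto simp: is_cld_def left_divisor_iff)
  have "unimodular X" "unimodular Y"
    using assms(1,2) C X Y by (auto simp: prime_matrix_def)
  obtain V where V: "unimodular V" "Y ** V = mat 1"
    using \<open>unimodular Y\<close> by (rule unimodular_inverse)
  \<comment> \<open>\<open>V\<close> is the inverse of \<open>Y\<close>, so the middle factor
    collapses and \<open>C ** X\<close> remains.\<close>
  have "B ** (V ** X) = C ** (Y ** V) ** X"
    by (simp only: Y matrix_mul_assoc)
  then have "A = B ** (V ** X)"
    by (simp add: X V)
  moreover have "unimodular (V ** X)"
    using V \<open>unimodular X\<close> by (simp add: unimodular_mult)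
  ultimately show False
    using different by blast
qed

theorem proposition1:
  fixes A B :: "int^'n^'n"
  assumes "CARD('n) > 1"
    and "prime_matrix A" and "prime_matrix B"
    and "\<not> (\<exists>U. unimodular U \<and> A = B ** U)"
  shows "left_coprime A B"
proof -
  have unimod: "unimodular C" if "is_cld C {A, B}" for C
    using is_cld_prime_matrices_unimodular[OF assms(2-4) that] .
  \<comment> \<open>The integer inverse of the unimodular \<open>C\<close> is the cofactor that
    makes \<open>C\<close> divide the identity.\<close>
  have "left_divisor C (mat 1)" if "is_cld C {A, B}" for C
  proof -
    from unimod[OF that] obtain V where "C ** V = mat 1"
      by (rule unimodular_inverse)
    then have "mat 1 = C ** V" ..
    moreover have "det C \<noteq> 0"
      using unimod[OF that] by (auto simp: unimodular_def)
    ultimately show ?thesis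
      unfolding left_divisor_iff by blast
  qed
  moreover have "is_cld (mat 1) {A, B}"
    by (simp add: is_cld_def left_divisor_iff)
  ultimately have "is_gcld (mat 1) {A, B}"
    by (simp add: is_gcld_def)
  \<comment> \<open>Any other gcld is in particular a cld, hence unimodular as well.\<close>
  then show ?thesis
    using unimod by (auto simp: left_coprime_def is_gcld_def)
qed

end
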